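(* Let $f(X)=a_0+a_1X+\cdots+a_nX^n\in\mathbb{Z}[X]$ be a polynomial of degree $n\ge 2$ such that all partial sums $a_n+a_{n-1}+\cdots+a_{n-j}$, $0\le j\le n$, are non-negative. If for some integer $m>1+\frac{1}{\sin\frac{\pi}{n}}$ we have $f(m)=p^k$ with $p$ a prime number, $k$ a positive integer, and $p\nmid f'(m)$, then $f$ is irreducible over $\mathbb{Q}$.
   Context: Here $f'$ denotes the derivative of $f$. *)

theory Defs
  imports Complex_Main "HOL-Computational_Algebra.Computational_Algebra"
begin

end

theory Submission
  imports Defs
begin

text \<open>
  Abel summation shows that the shifted polynomial \<open>f (1 + y)\<close> has non-negative coefficients, so it
  has no zero in the sector \<open>\<bar>Arg y\<bar> < pi / n\<close>: off the positive real axis, the imaginary parts of its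
  non-zero terms never have opposite signs, and that of the leading term does not vanish. Hence every
  root of \<open>f\<close> has distance at least \<open>(m - 1) sin (pi / n) > 1\<close> from \<open>m\<close>, and every non-constant integer
  factor of \<open>f\<close> takes a value of modulus greater than 1 at \<open>m\<close>, which is then divisible by \<open>p\<close>. In a
  factorisation \<open>f = g h\<close> into non-constant factors, \<open>p\<close> would therefore also divide
  \<open>f' m = g' m h m + g m h' m\<close>.
\<close>

subsection \<open>Integer polynomials in rings containing the integers\<close>

lemma map_poly_of_int_add:
  "map_poly (of_int :: int \<Rightarrow> 'a :: comm_ring_1) (p + q) = map_poly of_int p + map_poly of_int q"
  by (rule poly_eqI) (simp add: coeff_map_poly)

lemma map_poly_of_int_mult:
  "map_poly (of_int :: int \<Rightarrow> 'a :: comm_ring_1) (p * q) = map_poly of_int p * map_poly of_int q"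
  by (rule poly_eqI) (simp add: coeff_map_poly coeff_mult)

lemma map_poly_of_int_smult:
  "map_poly (of_int :: int \<Rightarrow> 'a :: comm_ring_1) (smult c p) = smult (of_int c) (map_poly of_int p)"
  by (rule poly_eqI) (simp add: coeff_map_poly)

lemma map_poly_of_int_pcompose:
  "map_poly (of_int :: int \<Rightarrow> 'a :: comm_ring_1) (pcompose p q) =
     pcompose (map_poly of_int p) (map_poly of_int q)"
  by (induction p)
    (simp_all add: pcompose_pCons map_poly_pCons map_poly_of_int_add map_poly_of_int_mult)

lemma poly_map_poly_of_int:
  "poly (map_poly (of_int :: int \<Rightarrow> 'a :: comm_ring_1) p) (of_int x) = of_int (poly p x)"
  by (induction p) (simp_all add: map_poly_pCons)

lemma inj_map_poly_of_int: "inj (map_poly (of_int :: int \<Rightarrow> 'a :: {comm_ring_1, ring_char_0}))"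
proof (rule injI)
  fix p q :: "int poly"
  assume eq: "map_poly (of_int :: int \<Rightarrow> 'a) p = map_poly of_int q"
  show "p = q"
  proof (rule poly_eqI)
    fix i
    have "(of_int (coeff p i) :: 'a) = of_int (coeff q i)"
      using arg_cong[OF eq, of "\<lambda>r. coeff r i"] by (simp add: coeff_map_poly)
    then show "coeff p i = coeff q i" by simp
  qed
qed

lemma degree_map_poly_of_int:
  "degree (map_poly (of_int :: int \<Rightarrow> 'a :: {comm_ring_1, ring_char_0}) p) = degree p"
  by (rule degree_map_poly) auto

lemma rat_poly_clear_denominators:
  fixes p :: "rat poly"
  obtains c :: int and q :: "int poly" where "c > 0" "smult (of_int c) p = map_poly of_int q"
proof -
  have "\<exists>c > 0. \<exists>q. smult (of_int c) p = map_poly of_int q"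
  proof (induction p)
    case 0
    show ?case by (intro exI[of _ 1] conjI exI[of _ 0]) auto
  next
    case (pCons a p)
    then obtain c q where c: "c > 0" "smult (of_int c) p = map_poly of_int q" by blast
    obtain u v where uv: "a = of_int u / of_int v" "v > 0"
      by (cases a) (auto simp: Fract_of_int_quotient)
    have "smult (of_int (c * v)) (pCons a p) = map_poly of_int (pCons (c * u) (smult v q))"
      using uv c(2)
      by (simp add: map_poly_pCons map_poly_of_int_smult flip: c(2)) (simp add: mult.commute)
    then show ?case using c(1) uv(2) by (intro exI[of _ "c * v"]) auto
  qed
  then show thesis using that by blast
qed

text \<open>Gauss's lemma. Clearing denominators gives \<open>c * d * f = G * H\<close> over the
  integers; primitive parts are multiplicative and do not see the positive constant
  \<open>c * d\<close>, and the content of \<open>f\<close> is put back into the first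
  factor.\<close>

lemma int_poly_factors_of_rat_factors:
  fixes f :: "int poly" and a b :: "rat poly"
  assumes "map_poly of_int f = a * b"
  obtains g h where "f = g * h" "degree g = degree a" "degree h = degree b"
proof -
  obtain c G where c: "c > 0" "smult (of_int c) a = map_poly of_int G"
    by (rule rat_poly_clear_denominators)
  obtain d H where d: "d > 0" "smult (of_int d) b = map_poly of_int H"
    by (rule rat_poly_clear_denominators)
  have "map_poly (of_int :: int \<Rightarrow> rat) (smult (c * d) f) = map_poly of_int (G * H)"
    unfolding map_poly_of_int_smult map_poly_of_int_mult assms
    by (simp add: mult.commute flip: c(2) d(2))
  then have "smult (c * d) f = G * H"
    using inj_map_poly_of_int by (metis injD)
  then have "primitive_part (smult (c * d) f) = primitive_part G * primitive_part H"
    by (simp add: primitive_part_mult)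
  then have "primitive_part f = primitive_part G * primitive_part H"
    using c(1) d(1) by (simp add: primitive_part_smult)
  then have split: "f = smult (content f) (primitive_part G) * primitive_part H"
    by (metis content_times_primitive_part mult_smult_left)
  have dG: "degree G = degree a"
    using c degree_map_poly_of_int[where 'a = rat, of G]
    by (metis degree_smult_eq of_int_0_eq_iff less_irrefl)
  have dH: "degree H = degree b"
    using d degree_map_poly_of_int[where 'a = rat, of H]
    by (metis degree_smult_eq of_int_0_eq_iff less_irrefl)
  show thesis
  proof (cases "f = 0")
    \<comment> \<open>Here \<open>content f = 0\<close>, so the first factor in \<open>split\<close>
      is 0 and its degree may differ from that of \<open>a\<close>. The zero is therefore placed on
      the side where the rational factor vanishes.\<close>
    case True
    then have "a = 0 \<or> b = 0" using assms by simp
    then show thesis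
    proof
      assume "a = 0"
      then show thesis using True dH that[of 0 H] by simp
    next
      assume "b = 0"
      then show thesis using True dG that[of G 0] by simp
    qed
  next
    case False
    then show thesis using that[OF split] dG dH by simp
  qed
qed

subsection \<open>Zero-free sectors and discs\<close>

text \<open>Writing \<open>f = a + X q\<close> gives
  \<open>f (1 + y) = a + q (1 + y) + y q (1 + y)\<close>. The tail sums of \<open>q\<close> are
  those of \<open>f\<close> moved by one index, so induction applies to \<open>q\<close>. Each
  coefficient of positive index is a sum of two coefficients of \<open>q (1 + y)\<close>, and the
  constant one is \<open>f 1\<close>, the full sum.\<close>

lemma pcompose_shift_coeff_nonneg:
  fixes f :: "'a :: linordered_idom poly"
  assumes "degree f \<le> N" "\<And>i. i \<le> N \<Longrightarrow> 0 \<le> (\<Sum>l=i..N. coeff f l)"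
  shows "0 \<le> coeff (pcompose f [:1, 1:]) j"
  using assms
proof (induction N arbitrary: f j)
  case 0
  then obtain a where "f = [:a:]" by (auto elim: degree_eq_zeroE)
  then show ?case using "0.prems"(2)[of 0] by (cases j) (auto simp: pcompose_pCons)
next
  case (Suc N)
  obtain a q where f: "f = pCons a q" by (cases f)
  have dq: "degree q \<le> N" using Suc.prems(1) by (auto simp: f split: if_splits)
  have "0 \<le> (\<Sum>l=i..N. coeff q l)" if "i \<le> N" for i
    using Suc.prems(2)[of "Suc i"] that unfolding sum.shift_bounds_cl_Suc_ivl by (simp add: f)
  then have IH: "0 \<le> coeff (pcompose q [:1, 1:]) j" for j
    using Suc.IH[OF dq] by blast
  show ?case
  proof (cases j)
    case 0
    have "coeff (pcompose f [:1, 1:]) 0 = poly f 1"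
      by (simp flip: poly_0_coeff_0 add: poly_pcompose)
    also have "\<dots> = (\<Sum>l\<le>Suc N. coeff f l)"
      using arg_cong[OF poly_as_sum_of_monoms'[OF Suc.prems(1)], of "\<lambda>r. poly r 1"]
      by (simp add: poly_sum poly_monom)
    finally show ?thesis using 0 Suc.prems(2)[of 0] by (simp add: atMost_atLeast0)
  next
    case (Suc i)
    then show ?thesis using IH[of i] IH[of j] by (simp add: f pcompose_pCons)
  qed
qed

lemma poly_nonneg_coeffs_sector_nonzero:
  fixes q :: "int poly"
  assumes nonneg: "\<And>i. coeff q i \<ge> 0" and deg: "degree q > 0" and r: "r > 0"
    and \<theta>: "\<bar>\<theta>\<bar> < pi / real (degree q)"
  shows "poly (map_poly of_int q) (rcis r \<theta>) \<noteq> 0"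
proof
  let ?n = "degree q"
  assume "poly (map_poly of_int q) (rcis r \<theta>) = 0"
  then have zero: "(\<Sum>i\<le>?n. of_int (coeff q i) * rcis (r ^ i) (real i * \<theta>)) = 0"
    by (simp add: poly_altdef degree_map_poly_of_int coeff_map_poly DeMoivre2)
  have lead: "coeff q ?n > 0"
    using nonneg[of ?n] deg by (metis degree_0 leading_coeff_0_iff less_irrefl order_le_less)
  show False
  proof (cases "\<theta> = 0")
    case True
    \<comment> \<open>On the positive real axis all imaginary parts vanish, so real parts are
      compared instead.\<close>
    have "0 < (\<Sum>i\<le>?n. of_int (coeff q i) * r ^ i)"
      by (rule sum_pos2[of _ ?n]) (use lead nonneg r in auto)
    also have "\<dots> = Re (\<Sum>i\<le>?n. of_int (coeff q i) * rcis (r ^ i) (real i * \<theta>))"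
      by (simp add: True)
    finally show False by (simp add: zero)
  next
    case False
    have angle: "real i * \<bar>\<theta>\<bar> < pi" if "i \<le> ?n" for i
    proof -
      have "real i * \<bar>\<theta>\<bar> \<le> real ?n * \<bar>\<theta>\<bar>" using that by (intro mult_right_mono) auto
      also have "\<dots> < pi" using \<theta> deg by (simp add: field_simps)
      finally show ?thesis .
    qed
    \<comment> \<open>With the absolute value of the angle, all multiples lie in
      \<open>[0, pi)\<close>, where the sine is non-negative. Since sine is odd, the factor
      \<open>sgn \<theta>\<close> then returns to the angle itself.\<close>
    have "0 < (\<Sum>i\<le>?n. of_int (coeff q i) * (r ^ i * sin (real i * \<bar>\<theta>\<bar>)))"
    proof (rule sum_pos2[of _ ?n])
      show "0 < of_int (coeff q ?n) * (r ^ ?n * sin (real ?n * \<bar>\<theta>\<bar>))"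
        using lead r angle[of ?n] False deg by (intro mult_pos_pos sin_gt_zero) auto
      show "0 \<le> of_int (coeff q i) * (r ^ i * sin (real i * \<bar>\<theta>\<bar>))" if "i \<in> {..?n}" for i
        using nonneg[of i] r angle[of i] that by (intro mult_nonneg_nonneg sin_ge_zero) auto
    qed auto
    also have "\<dots> = (\<Sum>i\<le>?n. sgn \<theta> * (of_int (coeff q i) * (r ^ i * sin (real i * \<theta>))))"
      using False by (intro sum.cong) (auto simp: sgn_if abs_if)
    also have "\<dots> = sgn \<theta> * Im (\<Sum>i\<le>?n. of_int (coeff q i) * rcis (r ^ i) (real i * \<theta>))"
      by (simp add: sum_distrib_left)
    finally show False by (simp add: zero)
  qed
qed

text \<open>By the law of cosines, with \<open>r = cmod y\<close>, the squared distance is at least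
  \<open>t^2 - 2 t r cos \<alpha> + r^2 = (t sin \<alpha>)^2 + (r - t cos
  \<alpha>)^2\<close>.\<close>

lemma dist_outside_sector:
  assumes "0 \<le> \<alpha>" "\<alpha> \<le> \<bar>Arg y\<bar>" "0 \<le> t" "0 \<le> sin \<alpha>"
  shows "t * sin \<alpha> \<le> cmod (of_real t - y)"
proof -
  define r \<theta> where "r = cmod y" and "\<theta> = Arg y"
  have y: "y = rcis r \<theta>" by (simp add: r_def \<theta>_def rcis_cmod_Arg)
  have "cos \<theta> = cos \<bar>\<theta>\<bar>" by (simp add: abs_if)
  also have "\<dots> \<le> cos \<alpha>"
    using assms(1,2) Arg_bounded[of y] by (intro cos_monotone_0_pi_le) (auto simp: \<theta>_def)
  finally have "t * r * cos \<theta> \<le> t * r * cos \<alpha>"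
    using assms(3) by (intro mult_left_mono) (auto simp: r_def)
  moreover have "0 \<le> (r - t * cos \<alpha>)\<^sup>2" by simp
  moreover have "(t * sin \<alpha>)\<^sup>2 = t\<^sup>2 - (t * cos \<alpha>)\<^sup>2"
    by (simp add: power_mult_distrib sin_squared_eq algebra_simps)
  moreover have "(cmod (of_real t - y))\<^sup>2 = t\<^sup>2 - 2 * (t * r * cos \<theta>) + r\<^sup>2"
  proof -
    have "(cmod (of_real t - y))\<^sup>2 = (t - r * cos \<theta>)\<^sup>2 + (r * sin \<theta>)\<^sup>2"
      by (simp add: cmod_power2 y)
    also have "\<dots> = t\<^sup>2 - 2 * (t * r * cos \<theta>) + r\<^sup>2 * ((sin \<theta>)\<^sup>2 + (cos \<theta>)\<^sup>2)"
      by (simp only: power_mult_distrib power2_diff distrib_left)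
    finally show ?thesis by simp
  qed
  ultimately have "(t * sin \<alpha>)\<^sup>2 \<le> (cmod (of_real t - y))\<^sup>2"
    by (simp add: power2_diff mult.assoc mult.left_commute)
  then show ?thesis by (rule power2_le_imp_le) simp
qed

text \<open>Over the complex numbers \<open>poly p z\<close> is the leading coefficient times the
  product of the \<open>z - x\<close> over the roots \<open>x\<close>, and each of these factors has
  norm above 1.\<close>

lemma norm_poly_gt_lead_coeff:
  fixes p :: "complex poly"
  assumes "degree p > 0" "\<And>x. poly p x = 0 \<Longrightarrow> 1 < norm (z - x)"
  shows "norm (lead_coeff p) < norm (poly p z)"
proof -
  have p0: "p \<noteq> 0" using assms(1) by auto
  then obtain A where A: "size A = degree p" "p = smult (lead_coeff p) (\<Prod>x\<in>#A. [:-x, 1:])"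
    using alg_closed_imp_factorization by blast
  have eval: "poly p w = lead_coeff p * (\<Prod>x\<in>#A. w - x)" for w
    by (subst A(2)) (simp add: poly_prod_mset algebra_simps)
  have "1 < norm (z - x)" if "x \<in># A" for x
    using that by (intro assms(2)) (auto simp: eval)
  moreover have "A \<noteq> {#}" using A(1) assms(1) by auto
  ultimately have "1 < norm (\<Prod>x\<in>#A. z - x)"
  proof (induction A)
    case (add x A)
    \<comment> \<open>The last root is separate: the product over the rest is then empty and equals
      1.\<close>
    then have "1 < norm (z - x)" "A = {#} \<or> 1 < norm (\<Prod>x\<in>#A. z - x)" by auto
    then show ?case by (auto simp: norm_mult intro: less_1_mult)
  qed simp
  then show ?thesis using p0 by (simp add: eval norm_mult)
qed

theorem corollary3p11:
  fixes f :: "int poly" and n p k :: nat and m :: int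
  assumes "degree f = n" and "n \<ge> 2"
    and "\<forall>j\<le>n. (\<Sum>i=0..j. coeff f (n - i)) \<ge> 0"
    and "real_of_int m > 1 + 1 / sin (pi / real n)"
    and "prime p" and "k > 0"
    and "poly f m = int p ^ k"
    and "\<not> int p dvd poly (pderiv f) m"
  shows "irreducible (map_poly rat_of_int f)"
proof (rule irreducibleI)
  have f0: "f \<noteq> 0" using assms(1,2) by auto
  then show "map_poly rat_of_int f \<noteq> 0"
    by (metis assms(1,2) degree_0 degree_map_poly_of_int not_numeral_le_zero)
  show "\<not> map_poly rat_of_int f dvd 1"
    using assms(1,2) f0 degree_map_poly_of_int[where 'a = rat, of f]
    by (metis is_unit_iff_degree degree_0 not_numeral_le_zero)
  have sin_pos: "0 < sin (pi / real n)"
    using assms(2) by (intro sin_gt_zero) (auto simp: field_simps)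
  define q where "q = pcompose f [:1, 1:]"
  have deg_q: "degree q = n" using assms(1) by (simp add: q_def degree_pcompose)
  have "0 \<le> (\<Sum>l=i..n. coeff f l)" if "i \<le> n" for i
  proof -
    have "(\<Sum>l=i..n. coeff f l) = (\<Sum>l=0..n - i. coeff f (n - l))"
      by (rule sum.reindex_bij_witness[of _ "\<lambda>l. n - l" "\<lambda>l. n - l"]) (use that in auto)
    then show ?thesis using assms(3) by simp
  qed
  then have q_nonneg: "0 \<le> coeff q i" for i
    unfolding q_def using assms(1) by (intro pcompose_shift_coeff_nonneg[of f n]) auto
  have far: "1 < norm (of_int m - x)" if "poly (map_poly of_int f) x = 0" for x :: complex
  proof -
    define y where "y = x - 1"
    have "poly (map_poly of_int q) y = 0"
      using that by (simp add: q_def y_def map_poly_of_int_pcompose poly_pcompose map_poly_pCons)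
    \<comment> \<open>The origin is kept apart because it has no polar form with positive
      radius.\<close>
    then have "y = 0 \<or> pi / real n \<le> \<bar>Arg y\<bar>"
      using poly_nonneg_coeffs_sector_nonzero[of q "cmod y" "Arg y"] q_nonneg assms(2)
      by (force simp: rcis_cmod_Arg deg_q)
    moreover have t: "1 < (real_of_int m - 1) * sin (pi / real n)"
      using assms(4) sin_pos by (simp add: field_simps)
    moreover have t0: "0 \<le> real_of_int m - 1"
      using assms(4) sin_pos by (smt (verit) divide_pos_pos)
    \<comment> \<open>This settles \<open>y = 0\<close>, where the distance is \<open>m - 1\<close>
      itself.\<close>
    moreover have "(real_of_int m - 1) * sin (pi / real n) \<le> real_of_int m - 1"
      using t0 mult_left_mono[OF sin_le_one] by fastforce
    ultimately have "1 < norm (of_real (real_of_int m - 1) - y)"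
      using dist_outside_sector[of "pi / real n" y "real_of_int m - 1"] sin_pos
      by (auto simp del: of_real_diff)
    then show ?thesis by (simp add: y_def)
  qed
  have value_gt_1: "1 < \<bar>poly g m\<bar>" if "g dvd f" "degree g > 0" for g
  proof -
    have "norm (lead_coeff (map_poly complex_of_int g)) < norm (poly (map_poly of_int g) (of_int m :: complex))"
    proof (rule norm_poly_gt_lead_coeff)
      fix x :: complex
      assume "poly (map_poly of_int g) x = 0"
      then show "1 < norm (of_int m - x)"
        using that(1) by (intro far) (auto simp: map_poly_of_int_mult elim!: dvdE)
    qed (use that in \<open>simp add: degree_map_poly_of_int\<close>)
    \<comment> \<open>The leading coefficient is a non-zero integer, hence of modulus at least
      1.\<close>
    then have "\<bar>lead_coeff g\<bar> < \<bar>poly g m\<bar>"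
      by (simp add: degree_map_poly_of_int coeff_map_poly poly_map_poly_of_int)
    moreover have "lead_coeff g \<noteq> 0" using that(2) by auto
    ultimately show ?thesis by linarith
  qed
  have value_dvd: "int p dvd poly g m" if "g dvd f" "degree g > 0" for g
  proof -
    have "poly g m dvd int p ^ k"
      using that(1) by (metis assms(7) dvdE dvd_triv_left poly_mult)
    moreover have "prime (int p)" using assms(5) by simp
    ultimately obtain i where "normalize (poly g m) = normalize (int p ^ i)"
      using divides_primepow_weak by blast
    then have "\<bar>poly g m\<bar> = int p ^ i" by simp
    moreover from this have "i \<noteq> 0" using value_gt_1[OF that] by (metis less_irrefl power_0)
    ultimately have "int p dvd \<bar>poly g m\<bar>" by (simp add: dvd_power)
    then show ?thesis by simp
  qed
  fix a b :: "rat poly"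
  assume ab: "map_poly rat_of_int f = a * b"
  obtain g h where gh: "f = g * h" "degree g = degree a" "degree h = degree b"
    using int_poly_factors_of_rat_factors[OF ab] .
  have "degree g = 0 \<or> degree h = 0"
  proof (rule ccontr)
    assume "\<not> ?thesis"
    then have "int p dvd poly g m" "int p dvd poly h m"
      using value_dvd[of g] value_dvd[of h] gh(1) by auto
    then have "int p dvd poly (pderiv f) m" by (simp add: gh(1) pderiv_mult)
    then show False using assms(8) by contradiction
  qed
  \<comment> \<open>Degree 0 also covers the zero polynomial, which is no unit.\<close>
  moreover have "a \<noteq> 0" "b \<noteq> 0"
    using ab \<open>map_poly rat_of_int f \<noteq> 0\<close> by auto
  ultimately show "a dvd 1 \<or> b dvd 1"
    using gh(2,3) by (simp add: is_unit_iff_degree)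
qed

end
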